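(* Let $G=(S,T;E)$ with $S=\{s_1,\dots,s_n\}$, $d\in\mathbb Z_+$, $l\in\{1,2,3,4\}$, and let $M,M^*$ be $d$-distance matchings of $G$ such that $M$ is $l$-locally optimal with respect to $M^*$. Then $|M^*|\le\varrho_l|M|$, where $\varrho_1=3$, $\varrho_2=2$, $\varrho_3=\frac95$ and $\varrho_4=\frac53$.
   Context: $G$ is a finite bipartite graph without loops or parallel edges; the nodes of $S$ are in the fixed order $s_1,\dots,s_n$. A $d$-distance matching is a subset $M\subseteq E$ such that every node of $S$ is incident to at most one edge of $M$, and whenever $s_it,s_jt\in M$ with $i\ne j$, $t\in T$, we have $|j-i|\ge d$. For an edge $e^*\in E$ and a $d$-distance matching $M$, the hit set $\mathcal H(e^*,M)$ is the inclusion-wise minimal subset of $M$ such that $(M\setminus\mathcal H(e^*,M))\cup\{e^*\}$ is a $d$-distance matching; for $X\subseteq E$, $\mathcal H(X,M)=\bigcup_{e^*\in X}\mathcal H(e^*,M)$. $M$ is $l$-locally optimal with respect to $M^*$ if there is no $X\subseteq M^*\setminus M$ with $l\ge|X|>|\mathcal H(X,M)|$. *)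

theory Defs
  imports Complex_Main
begin

text \<open>
  The bipartite graph \<open>(S, T; E)\<close> is given by finite sets \<open>S\<close>, \<open>T\<close> over separate types, so the two
  colour classes are disjoint, and by edges that are pairs in \<open>S \<times> T\<close>, so there are neither loops
  nor parallel edges. The fixed order of \<open>S\<close> is the enumeration \<open>s 1, \<dots>, s n\<close>.
\<close>

definition ordered_bipartite_graph ::
    "nat \<Rightarrow> (nat \<Rightarrow> 'a) \<Rightarrow> 'a set \<Rightarrow> 'b set \<Rightarrow> ('a \<times> 'b) set \<Rightarrow> bool" where
  "ordered_bipartite_graph n s S T E \<longleftrightarrow>
     bij_betw s {1..n} S \<and> finite T \<and> E \<subseteq> S \<times> T"

definition distance_matching ::
    "nat \<Rightarrow> (nat \<Rightarrow> 'a) \<Rightarrow> 'a set \<Rightarrow> 'b set \<Rightarrow> ('a \<times> 'b) set \<Rightarrow> nat \<Rightarrow> ('a \<times> 'b) set \<Rightarrow> bool" where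
  "distance_matching n s S T E d M \<longleftrightarrow>
     M \<subseteq> E \<and>
     (\<forall>u\<in>S. card {e \<in> M. fst e = u} \<le> 1) \<and>
     (\<forall>i\<in>{1..n}. \<forall>j\<in>{1..n}. \<forall>t\<in>T.
        (s i, t) \<in> M \<and> (s j, t) \<in> M \<and> i \<noteq> j \<longrightarrow> \<bar>int j - int i\<bar> \<ge> int d)"

definition is_hit_set ::
    "nat \<Rightarrow> (nat \<Rightarrow> 'a) \<Rightarrow> 'a set \<Rightarrow> 'b set \<Rightarrow> ('a \<times> 'b) set \<Rightarrow> nat \<Rightarrow>
     'a \<times> 'b \<Rightarrow> ('a \<times> 'b) set \<Rightarrow> ('a \<times> 'b) set \<Rightarrow> bool" where
  "is_hit_set n s S T E d e M H \<longleftrightarrow>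
     H \<subseteq> M \<and> distance_matching n s S T E d ((M - H) \<union> {e}) \<and>
     (\<forall>H'. H' \<subset> H \<longrightarrow> \<not> distance_matching n s S T E d ((M - H') \<union> {e}))"

text \<open>Lemma \<open>ex1_hit_set\<close> below shows that the description is proper for every edge \<open>e\<close>.\<close>

definition hit_set ::
    "nat \<Rightarrow> (nat \<Rightarrow> 'a) \<Rightarrow> 'a set \<Rightarrow> 'b set \<Rightarrow> ('a \<times> 'b) set \<Rightarrow> nat \<Rightarrow>
     'a \<times> 'b \<Rightarrow> ('a \<times> 'b) set \<Rightarrow> ('a \<times> 'b) set" where
  "hit_set n s S T E d e M = (THE H. is_hit_set n s S T E d e M H)"

definition hit_set_of ::
    "nat \<Rightarrow> (nat \<Rightarrow> 'a) \<Rightarrow> 'a set \<Rightarrow> 'b set \<Rightarrow> ('a \<times> 'b) set \<Rightarrow> nat \<Rightarrow>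
     ('a \<times> 'b) set \<Rightarrow> ('a \<times> 'b) set \<Rightarrow> ('a \<times> 'b) set" where
  "hit_set_of n s S T E d X M = (\<Union>e\<in>X. hit_set n s S T E d e M)"

definition locally_optimal ::
    "nat \<Rightarrow> (nat \<Rightarrow> 'a) \<Rightarrow> 'a set \<Rightarrow> 'b set \<Rightarrow> ('a \<times> 'b) set \<Rightarrow> nat \<Rightarrow>
     nat \<Rightarrow> ('a \<times> 'b) set \<Rightarrow> ('a \<times> 'b) set \<Rightarrow> bool" where
  "locally_optimal n s S T E d l M Mstar \<longleftrightarrow>
     \<not> (\<exists>X. X \<subseteq> Mstar - M \<and> l \<ge> card X \<and> card X > card (hit_set_of n s S T E d X M))"

text \<open>Only the values at \<open>1, 2, 3, 4\<close> are meant.\<close>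

definition \<rho> :: "nat \<Rightarrow> real" where
  "\<rho> l = (if l = 1 then 3 else if l = 2 then 2 else if l = 3 then 9/5 else 5/3)"

lemma distance_matching_pairwise:
  assumes G: "ordered_bipartite_graph n s S T E"
  shows "distance_matching n s S T E d M \<longleftrightarrow>
    M \<subseteq> E \<and> (\<forall>x\<in>M. \<forall>y\<in>M. distance_matching n s S T E d {x, y})"
proof -
  have "finite S" using G by (auto simp: ordered_bipartite_graph_def bij_betw_def)
  then have fE: "finite E"
    using G finite_subset[of E "S \<times> T"] by (simp add: ordered_bipartite_graph_def)
  have c: "card {e \<in> N. fst e = u} \<le> 1 \<longleftrightarrow>
      (\<forall>x\<in>N. \<forall>y\<in>N. fst x = u \<and> fst y = u \<longrightarrow> x = y)"
    if "N \<subseteq> E" for N u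
  proof -
    have "finite {e \<in> N. fst e = u}" using that fE by (auto intro: finite_subset)
    then show ?thesis unfolding One_nat_def by (subst card_le_Suc0_iff_eq) blast+
  qed
  have ES: "fst x \<in> S" if "x \<in> E" for x
    using G that by (auto simp: ordered_bipartite_graph_def)
  define apart where "apart N \<longleftrightarrow> (\<forall>i\<in>{1..n}. \<forall>j\<in>{1..n}. \<forall>t\<in>T.
        (s i, t) \<in> N \<and> (s j, t) \<in> N \<and> i \<noteq> j \<longrightarrow> \<bar>int j - int i\<bar> \<ge> int d)" for N :: "('a \<times> 'b) set"
  have D: "distance_matching n s S T E d N \<longleftrightarrow> N \<subseteq> E \<and>
     (\<forall>x\<in>N. \<forall>y\<in>N. fst x = fst y \<longrightarrow> x = y) \<and> apart N" for N
  proof (cases "N \<subseteq> E")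
    case True
    then have "(\<forall>u\<in>S. card {e \<in> N. fst e = u} \<le> 1) \<longleftrightarrow>
        (\<forall>x\<in>N. \<forall>y\<in>N. fst x = fst y \<longrightarrow> x = y)"
      using ES by (simp only: c) blast
    then show ?thesis by (simp only: distance_matching_def apart_def)
  qed (simp add: distance_matching_def)
  have "apart M \<longleftrightarrow> (\<forall>x\<in>M. \<forall>y\<in>M. apart {x, y})"
  proof
    assume "apart M"
    then show "\<forall>x\<in>M. \<forall>y\<in>M. apart {x, y}"
      unfolding apart_def by (metis empty_iff insert_iff)
  next
    assume A: "\<forall>x\<in>M. \<forall>y\<in>M. apart {x, y}"
    show "apart M"
      unfolding apart_def
    proof (intro ballI impI)
      fix i j t
      assume "i \<in> {1..n}" "j \<in> {1..n}" "t \<in> T"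
        and h: "(s i, t) \<in> M \<and> (s j, t) \<in> M \<and> i \<noteq> j"
      moreover have "apart {(s i, t), (s j, t)}" using A h by blast
      ultimately show "int d \<le> \<bar>int j - int i\<bar>" unfolding apart_def by blast
    qed
  qed
  then show ?thesis unfolding D by auto
qed

lemma ex1_hit_set:
  assumes G: "ordered_bipartite_graph n s S T E"
    and M: "distance_matching n s S T E d M" and e: "e \<in> E"
  shows "\<exists>!H. is_hit_set n s S T E d e M H"
proof -
  let ?D = "distance_matching n s S T E d"
  define C where "C = {x \<in> M. \<not> ?D {x, e}}"
  note P = distance_matching_pairwise[OF G, of d]
  have single: "?D {e}"
  proof -
    have "{x. x = e \<and> fst x = u} \<subseteq> {e}" for u by auto
    then have "card {x. x = e \<and> fst x = u} \<le> 1" for u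
      using card_mono[of "{e}"] by fastforce
    moreover have "inj_on s {1..n}"
      using G by (simp add: ordered_bipartite_graph_def bij_betw_def)
    ultimately show ?thesis
      using e unfolding distance_matching_def by (auto dest: inj_onD)
  qed
  have iff: "?D ((M - H) \<union> {e}) \<longleftrightarrow> C \<subseteq> H" for H
  proof
    assume "?D ((M - H) \<union> {e})"
    then have "?D {x, e}" if "x \<in> M - H" for x
      using that by (subst (asm) P) blast
    then show "C \<subseteq> H" by (auto simp: C_def)
  next
    assume "C \<subseteq> H"
    then have h: "?D {x, e}" if "x \<in> M - H" for x using that by (auto simp: C_def)
    have MM: "?D {x, y}" if "x \<in> M" "y \<in> M" for x y
      using M that by (subst (asm) P) blast
    show "?D ((M - H) \<union> {e})"
    proof (subst P, intro conjI ballI)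
      show "(M - H) \<union> {e} \<subseteq> E" using M e by (auto simp: distance_matching_def)
    next
      fix x y
      assume "x \<in> (M - H) \<union> {e}" "y \<in> (M - H) \<union> {e}"
      then show "?D {x, y}"
        using h[of x] h[of y] MM[of x y] single insert_commute[of x y "{}"] by fastforce
    qed
  qed
  have "C \<subseteq> M" by (auto simp: C_def)
  then show ?thesis
    unfolding is_hit_set_def iff by (intro ex1I[of _ C]) blast+
qed

end

theory Submission
  imports Defs
begin

text \<open>
  Only two properties of the hit sets matter: every edge of \<open>M\<close> is hit by at most three edges of
  \<open>M\<^sup>*\<close>, and any at most \<open>l\<close> edges of \<open>M\<^sup>* - M\<close> hit at least that many edges. The bounds are then
  the case \<open>k = 3\<close> of a theorem of Hurkens and Schrijver on set systems. Let \<open>V\<close> be the union of the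
  \<open>a\<^sub>1\<close> singleton hit sets, \<open>a\<^sub>2\<close> the number of hit sets of size two, \<open>a\<close> the number of all hit sets
  and \<open>b\<close> the number of elements. Counting incidences gives \<open>3 a \<le> 3 b + 2 a\<^sub>1 + a\<^sub>2\<close>.
  Each bound is a linear combination of this, \<open>a\<^sub>1 + a\<^sub>2 \<le> a\<close> and one more inequality if \<open>l \<ge> 2\<close>.
  For \<open>l \<ge> 2\<close>, the singletons are distinct, so \<open>a\<^sub>1 \<le> b\<close>. For \<open>l \<ge> 3\<close>, no hit set of size two lies
  inside \<open>V\<close>, and counting incidences outside \<open>V\<close> gives \<open>a\<^sub>2 \<le> 3 (b - a\<^sub>1)\<close>. For \<open>l \<ge> 4\<close>, the hit
  sets of size two with only one element outside \<open>V\<close> have distinct such elements, which improves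
  this to \<open>a\<^sub>2 \<le> 2 (b - a\<^sub>1)\<close>.
\<close>

section \<open>Set systems of degree at most three with Hall's condition up to size
  \<open>l\<close>\<close>

locale sparse_cover =
  fixes A :: "'e set" and B :: "'v set" and N :: "'e \<Rightarrow> 'v set" and l :: nat
  assumes finA: "finite A" and finB: "finite B"
    and sub: "\<And>a. a \<in> A \<Longrightarrow> N a \<subseteq> B"
    and deg: "\<And>b. b \<in> B \<Longrightarrow> card {a \<in> A. b \<in> N a} \<le> 3"
    and hall: "\<And>X. X \<subseteq> A \<Longrightarrow> card X \<le> l \<Longrightarrow> card X \<le> card (\<Union>a\<in>X. N a)"
begin

lemma finite_N: "a \<in> A \<Longrightarrow> finite (N a)"
  using sub finB finite_subset by metis

lemma incidences_le:
  assumes "A' \<subseteq> A" "B' \<subseteq> B"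
  shows "(\<Sum>a\<in>A'. card (N a \<inter> B')) \<le> 3 * card B'"
proof -
  have fin: "finite A'" "finite B'" using assms finA finB finite_subset by auto
  have "(\<Sum>a\<in>A'. card (N a \<inter> B')) = (\<Sum>a\<in>A'. card {b \<in> B'. b \<in> N a})"
    by (intro sum.cong arg_cong[where f = card]) auto
  also have "\<dots> = (\<Sum>b\<in>B'. card {a \<in> A'. b \<in> N a})"
    using sum.swap_restrict[OF fin, of "\<lambda>_ _. 1::nat" "\<lambda>a b. b \<in> N a"] by simp
  also have "\<dots> \<le> (\<Sum>b\<in>B'. 3)"
  proof (rule sum_mono)
    fix b assume "b \<in> B'"
    have "card {a \<in> A'. b \<in> N a} \<le> card {a \<in> A. b \<in> N a}"
      using assms finA by (intro card_mono) auto
    also have "\<dots> \<le> 3" using deg assms \<open>b \<in> B'\<close> by auto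
    finally show "card {a \<in> A'. b \<in> N a} \<le> 3" .
  qed
  finally show ?thesis by simp
qed

text \<open>This is how \<open>hall\<close> yields contradictions below: a few sets are exhibited
  whose union has fewer elements than there are sets.\<close>

lemma card_le_if_Union_le:
  assumes "X \<subseteq> A" "card X \<le> l" "(\<Union>a\<in>X. N a) \<subseteq> Y" "finite Y"
  shows "card X \<le> card Y"
  using hall[OF assms(1,2)] card_mono[OF assms(4,3)] by linarith

definition A1 where "A1 = {a \<in> A. card (N a) = 1}"
definition A2 where "A2 = {a \<in> A. card (N a) = 2}"
definition V where "V = (\<Union>a\<in>A1. N a)"

lemma V_subset: "V \<subseteq> B"
  using sub by (auto simp: V_def A1_def)

lemma V_E:
  assumes "v \<in> V"
  obtains a where "a \<in> A" "N a = {v}"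
  using assms by (auto simp: V_def A1_def card_1_singleton_iff)

lemma N_nonempty:
  assumes "1 \<le> l" "a \<in> A"
  shows "card (N a) \<ge> 1"
  using hall[of "{a}"] assms by simp

text \<open>A set of size one or two falls short of size three by two or one. With these deficits
  added, each index contributes at least three, since \<open>hall\<close> rules out empty sets; the
  sizes alone sum to at most \<open>3 * card B\<close>.\<close>

lemma three_mult_card_le:
  assumes "1 \<le> l"
  shows "3 * card A \<le> 3 * card B + 2 * card A1 + card A2"
proof -
  have c: "card {a \<in> A. P a} = (\<Sum>a\<in>A. if P a then 1 else 0)" for P
    using finA by (simp add: sum.If_cases Int_def)
  have "3 * card A = (\<Sum>a\<in>A. 3)" by simp
  also have "\<dots> \<le> (\<Sum>a\<in>A. card (N a \<inter> B)
      + 2 * (if card (N a) = 1 then 1 else 0) + (if card (N a) = 2 then 1 else 0))"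
  proof (rule sum_mono)
    fix a assume "a \<in> A"
    then have "N a \<inter> B = N a" "card (N a) \<ge> 1" using sub N_nonempty assms by auto
    then show "3 \<le> card (N a \<inter> B)
      + 2 * (if card (N a) = 1 then 1 else 0) + (if card (N a) = 2 then 1 else 0)" by auto
  qed
  also have "\<dots> = (\<Sum>a\<in>A. card (N a \<inter> B)) + 2 * card A1 + card A2"
    unfolding A1_def A2_def c by (simp add: sum.distrib sum_distrib_left)
  also have "\<dots> \<le> 3 * card B + 2 * card A1 + card A2"
    using incidences_le[of A B] by simp
  finally show ?thesis .
qed

lemma card_A1_A2_le: "card A1 + card A2 \<le> card A"
proof -
  have "card (A1 \<union> A2) = card A1 + card A2"
    using finA by (intro card_Un_disjoint) (auto simp: A1_def A2_def)
  then show ?thesis using card_mono[OF finA, of "A1 \<union> A2"] by (auto simp: A1_def A2_def)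
qed

lemma card_le_l1:
  assumes "1 \<le> l"
  shows "card A \<le> 3 * card B"
  using three_mult_card_le[OF assms] card_A1_A2_le by simp

text \<open>Two equal singletons would be two sets on one element, so distinct indices in
  \<open>A1\<close> have disjoint sets.\<close>

lemma card_V:
  assumes "2 \<le> l"
  shows "card V = card A1"
proof -
  have "a = a'" if "a \<in> A" "a' \<in> A" "N a = {v}" "N a' = {v}" for a a' v
    using card_le_if_Union_le[of "{a, a'}" "{v}"] that assms by (cases "a = a'") auto
  then have "N a \<inter> N a' = {}" if "a \<in> A1" "a' \<in> A1" "a \<noteq> a'" for a a'
    using that by (force simp: A1_def card_1_singleton_iff)
  then have "card V = (\<Sum>a\<in>A1. card (N a))"
    unfolding V_def using finA finite_N by (intro card_UN_disjoint) (auto simp: A1_def)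
  then show ?thesis by (simp add: A1_def)
qed

lemma card_A1_le: "2 \<le> l \<Longrightarrow> card A1 \<le> card B"
  using card_V card_mono[OF finB V_subset] by simp

text \<open>Split \<open>2 * card A1 + card A2\<close> into \<open>card A1\<close>, bounded by
  \<open>card B\<close>, and \<open>card A1 + card A2\<close>, bounded by
  \<open>card A\<close>.\<close>

lemma card_le_l2:
  assumes "2 \<le> l"
  shows "card A \<le> 2 * card B"
  using three_mult_card_le card_A1_A2_le card_A1_le assms by simp

text \<open>Otherwise the set and the singletons of its two elements would be three sets on two
  elements.\<close>

lemma A2_not_subset_V:
  assumes "3 \<le> l" "e \<in> A2"
  shows "N e - V \<noteq> {}"
proof
  assume "N e - V = {}"
  moreover obtain u v where uv: "N e = {u, v}" "u \<noteq> v"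
    using assms by (auto simp: A2_def card_2_iff)
  ultimately have "u \<in> V" "v \<in> V" by auto
  then obtain a a' where a: "a \<in> A" "N a = {u}" "a' \<in> A" "N a' = {v}"
    by (metis V_E)
  then have "a \<noteq> a'" "e \<noteq> a" "e \<noteq> a'" using uv by auto
  then show False
    using card_le_if_Union_le[of "{e, a, a'}" "{u, v}"] a uv assms by (auto simp: A2_def)
qed

lemma card_diff_V: "2 \<le> l \<Longrightarrow> card (B - V) = card B - card A1"
  using card_V V_subset finB finite_subset by (metis card_Diff_subset)

lemma card_le_l3:
  assumes "3 \<le> l"
  shows "5 * card A \<le> 9 * card B"
proof -
  have "card A2 = (\<Sum>a\<in>A2. 1)" by simp
  also have "\<dots> \<le> (\<Sum>a\<in>A2. card (N a \<inter> (B - V)))"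
  proof (rule sum_mono)
    fix a assume a: "a \<in> A2"
    then have "N a \<inter> (B - V) = N a - V" using sub by (auto simp: A2_def)
    moreover have "finite (N a - V)" using a finite_N by (simp add: A2_def)
    ultimately show "1 \<le> card (N a \<inter> (B - V))"
      using A2_not_subset_V[OF assms a] by (simp add: Suc_le_eq card_gt_0_iff)
  qed
  also have "\<dots> \<le> 3 * card (B - V)"
    by (intro incidences_le) (auto simp: A2_def)
  finally have "card A2 + 3 * card A1 \<le> 3 * card B"
    using card_diff_V card_A1_le assms by simp
  \<comment> \<open>Half of the last inequality plus half of \<open>card_A1_A2_le\<close> bounds
    \<open>2 * card A1 + card A2\<close>; this is where 9/5 comes from.\<close>
  then show ?thesis using three_mult_card_le card_A1_A2_le assms by simp
qed

text \<open>Two such sets with distinct indices, together with the singletons of their elements in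
  \<open>V\<close>, would be four sets on three elements, or three sets on two if those elements
  coincide.\<close>

lemma A2_remainder_inj:
  assumes "4 \<le> l" and e: "e \<in> A2" "N e - V = {v}" and e': "e' \<in> A2" "N e' - V = {v}"
  shows "e = e'"
proof (rule ccontr)
  assume ne: "e \<noteq> e'"
  have "\<exists>u\<in>V. N x = {u, v}" if x: "x \<in> A2" "N x - V = {v}" for x
  proof -
    have "card (N x) = 2" "v \<in> N x" using x by (auto simp: A2_def)
    then obtain u where "N x = {u, v}" "u \<noteq> v"
      by (auto simp: card_2_iff doubleton_eq_iff)
    then show ?thesis using x by blast
  qed
  then obtain u u' where u: "u \<in> V" "N e = {u, v}" "u' \<in> V" "N e' = {u', v}"
    using e e' by metis
  obtain a a' where a: "a \<in> A" "N a = {u}" "a' \<in> A" "N a' = {u'}"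
    using u by (metis V_E)
  have v: "v \<noteq> u" "v \<noteq> u'" using u e by auto
  then have d: "e \<noteq> a" "e \<noteq> a'" "e' \<noteq> a" "e' \<noteq> a'" using a u by auto
  have A: "e \<in> A" "e' \<in> A" using e e' by (auto simp: A2_def)
  show False
  proof (cases "u = u'")
    case True
    then show False
      using card_le_if_Union_le[of "{e, e', a}" "{u, v}"] a u v d ne A assms(1) by auto
  next
    case False
    then have "a \<noteq> a'" using a by auto
    then show False
      using card_le_if_Union_le[of "{e, e', a, a'}" "{u, u', v}"] a u v d ne A False assms(1)
      by auto
  qed
qed

lemma card_le_l4:
  assumes "4 \<le> l"
  shows "3 * card A \<le> 5 * card B"
proof -
  define P where "P = {a \<in> A2. card (N a - V) = 1}"
  have finA2: "finite A2" using finA by (simp add: A2_def)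
  have PB: "card P \<le> card (B - V)"
  proof (rule card_inj_on_le)
    show "inj_on (\<lambda>a. the_elem (N a - V)) P"
      using A2_remainder_inj[OF assms]
      by (auto simp: inj_on_def P_def card_1_singleton_iff)
    show "(\<lambda>a. the_elem (N a - V)) ` P \<subseteq> B - V"
    proof
      fix w assume "w \<in> (\<lambda>a. the_elem (N a - V)) ` P"
      then obtain a where "a \<in> A" "N a - V = {w}"
        by (auto simp: P_def A2_def card_1_singleton_iff)
      then show "w \<in> B - V" using sub by blast
    qed
  qed (simp add: finB)
  have "2 * card A2 = (\<Sum>a\<in>A2. 2)" by simp
  \<comment> \<open>A pair outside \<open>P\<close> already has two incidences outside
    \<open>V\<close>; a pair in \<open>P\<close> has one, and the indicator supplies the other. The
    total correction is \<open>card P\<close>, hence at most \<open>card (B - V)\<close>.\<close>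
  also have "\<dots> \<le> (\<Sum>a\<in>A2. card (N a \<inter> (B - V)) + (if card (N a - V) = 1 then 1 else 0))"
  proof (rule sum_mono)
    fix a assume a: "a \<in> A2"
    then have "N a \<inter> (B - V) = N a - V" using sub by (auto simp: A2_def)
    moreover have "finite (N a - V)" using a finite_N by (simp add: A2_def)
    then have "card (N a - V) > 0"
      using A2_not_subset_V[OF _ a] assms by (simp add: card_gt_0_iff)
    ultimately show "2 \<le> card (N a \<inter> (B - V)) + (if card (N a - V) = 1 then 1 else 0)"
      by auto
  qed
  also have "\<dots> = (\<Sum>a\<in>A2. card (N a \<inter> (B - V))) + card P"
    using finA2 by (simp add: sum.distrib sum.If_cases Int_def P_def)
  also have "\<dots> \<le> 3 * card (B - V) + card (B - V)"
    using PB by (intro add_mono incidences_le) (auto simp: A2_def)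
  finally have "card A2 + 2 * card A1 \<le> 2 * card B"
    using card_diff_V card_A1_le assms by simp
  \<comment> \<open>The excess \<open>2 * card A1 + card A2\<close> is now bounded by
    \<open>2 * card B\<close> as it stands, which gives 5/3.\<close>
  then show ?thesis using three_mult_card_le assms by simp
qed

lemma card_le_rho:
  assumes "l \<in> {1, 2, 3, 4}"
  shows "real (card A) \<le> \<rho> l * real (card B)"
proof -
  consider "l = 1" | "l = 2" | "l = 3" | "l = 4" using assms by auto
  then show ?thesis
  proof cases
    case 1 then show ?thesis using card_le_l1 by (simp add: \<rho>_def)
  next
    case 2 then show ?thesis using card_le_l2 by (simp add: \<rho>_def)
  next
    case 3 then show ?thesis using card_le_l3 by (simp add: \<rho>_def)
  next
    case 4 then show ?thesis using card_le_l4 by (simp add: \<rho>_def)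
  qed
qed

end

section \<open>Conflicts between edges of distance matchings\<close>

lemma hit_set_subset_conflicts:
  assumes G: "ordered_bipartite_graph n s S T E"
    and M: "distance_matching n s S T E d M" and e: "e \<in> E"
  shows "hit_set n s S T E d e M \<subseteq> {x \<in> M. \<not> distance_matching n s S T E d {x, e}}"
proof
  let ?D = "distance_matching n s S T E d" and ?H = "hit_set n s S T E d e M"
  note P = distance_matching_pairwise[OF G, of d]
  have H: "is_hit_set n s S T E d e M ?H"
    unfolding hit_set_def using ex1_hit_set[OF assms] by (rule theI')
  fix x assume x: "x \<in> ?H"
  then have xM: "x \<in> M" using H by (auto simp: is_hit_set_def)
  have "\<not> ?D {x, e}"
  proof
    \<comment> \<open>An edge of the hit set compatible with \<open>e\<close> could be returned to
      the matching, against minimality: compatibility is a condition on pairs, and the only new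
      pairs are \<open>x\<close> with \<open>e\<close> and pairs inside \<open>M\<close>.\<close>
    assume xe: "?D {x, e}"
    have MM: "?D {y, z}" if "y \<in> M" "z \<in> M" for y z
      using M that by (subst (asm) P) blast
    have HH: "?D {y, z}" if "y \<in> (M - ?H) \<union> {e}" "z \<in> (M - ?H) \<union> {e}" for y z
      using H that unfolding is_hit_set_def by (subst (asm) P) blast
    have "?D ((M - (?H - {x})) \<union> {e})"
    proof (subst P, intro conjI ballI)
      show "(M - (?H - {x})) \<union> {e} \<subseteq> E" using M e by (auto simp: distance_matching_def)
    next
      fix y z
      assume "y \<in> (M - (?H - {x})) \<union> {e}" "z \<in> (M - (?H - {x})) \<union> {e}"
      then consider "y \<in> M" "z \<in> M" | "y \<in> (M - ?H) \<union> {e}" "z \<in> (M - ?H) \<union> {e}"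
        | "y = x" "z = e" | "y = e" "z = x"
        using xM by blast
      then show "?D {y, z}"
        using MM HH xe insert_commute[of e x "{}"] by cases auto
    qed
    moreover have "?H - {x} \<subset> ?H" using x by blast
    ultimately show False using H by (auto simp: is_hit_set_def)
  qed
  then show "x \<in> {x \<in> M. \<not> ?D {x, e}}" using xM by simp
qed

lemma conflict_cases:
  assumes G: "ordered_bipartite_graph n s S T E"
    and "(s i, t) \<in> E" "(s j, t') \<in> E" "i \<in> {1..n}" "j \<in> {1..n}"
    and nD: "\<not> distance_matching n s S T E d {(s i, t), (s j, t')}"
  shows "i = j \<or> t = t' \<and> \<bar>int j - int i\<bar> < int d"
proof (rule ccontr)
  assume neg: "\<not> ?thesis"
  have inj: "s k = s m \<longleftrightarrow> k = m" if "k \<in> {1..n}" "m \<in> {1..n}" for k m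
    using G that by (auto simp: ordered_bipartite_graph_def bij_betw_def inj_on_eq_iff)
  have "card {e \<in> {(s i, t), (s j, t')}. fst e = u} \<le> 1" for u
    unfolding One_nat_def using neg inj[of i j] assms(4,5)
    by (subst card_le_Suc0_iff_eq) auto
  moreover have "int d \<le> \<bar>int m - int k\<bar>"
    if "k \<in> {1..n}" "m \<in> {1..n}" "(s k, w) \<in> {(s i, t), (s j, t')}"
      "(s m, w) \<in> {(s i, t), (s j, t')}" "k \<noteq> m" for k m w
    using that inj assms(4,5) neg by auto
  ultimately have "distance_matching n s S T E d {(s i, t), (s j, t')}"
    using assms(2,3) unfolding distance_matching_def by blast
  with nD show False ..
qed

text \<open>One conflict at the common node of \<open>S\<close>, and one at \<open>t\<close> on each
  side of \<open>s i\<close>: two edges at \<open>t\<close> on the same side, both at distance less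
  than \<open>d\<close> from \<open>s i\<close>, would be too close to each other.\<close>

lemma card_conflicts_le_3:
  assumes G: "ordered_bipartite_graph n s S T E"
    and M: "distance_matching n s S T E d M" and x: "x \<in> E"
  shows "card {e \<in> M. \<not> distance_matching n s S T E d {x, e}} \<le> 3"
proof -
  have sT: "\<exists>i\<in>{1..n}. \<exists>t\<in>T. e = (s i, t)" if "e \<in> E" for e
    using G that by (force simp: ordered_bipartite_graph_def bij_betw_def)
  have ME: "M \<subseteq> E" using M by (simp add: distance_matching_def)
  have apart: "int d \<le> \<bar>int k - int j\<bar>"
    if "j \<in> {1..n}" "k \<in> {1..n}" "t \<in> T" "(s j, t) \<in> M" "(s k, t) \<in> M" "j \<noteq> k" for j k t
    using M that unfolding distance_matching_def by blast
  from sT[OF x] obtain i t where i: "i \<in> {1..n}" "t \<in> T" "x = (s i, t)" by blast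
  have "s i \<in> S" using G i by (auto simp: ordered_bipartite_graph_def bij_betw_def)
  define C1 where "C1 = {e \<in> M. fst e = s i}"
  define C2 where "C2 = {e \<in> M. \<exists>j\<in>{1..n}. e = (s j, t) \<and> j < i \<and> i < j + d}"
  define C3 where "C3 = {e \<in> M. \<exists>j\<in>{1..n}. e = (s j, t) \<and> i < j \<and> j < i + d}"
  have "finite S" using G by (auto simp: ordered_bipartite_graph_def bij_betw_def)
  then have "finite E"
    using G finite_subset[of E "S \<times> T"] by (simp add: ordered_bipartite_graph_def)
  then have "finite M" using ME finite_subset by blast
  then have fin: "finite C1" "finite C2" "finite C3" by (auto simp: C1_def C2_def C3_def)
  have c1: "card C1 \<le> 1" using M \<open>s i \<in> S\<close> by (auto simp: distance_matching_def C1_def)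
  have c2: "card C2 \<le> 1"
  proof -
    have "e = e'" if ee: "e \<in> C2" "e' \<in> C2" for e e'
    proof -
      obtain j k where "j \<in> {1..n}" "k \<in> {1..n}" "e = (s j, t)" "e' = (s k, t)" "e \<in> M" "e' \<in> M"
        "j < i" "i < j + d" "k < i" "i < k + d"
        using ee by (auto simp: C2_def)
      then show ?thesis using apart[of j k t] i by (cases "j = k") auto
    qed
    then show ?thesis unfolding One_nat_def using fin by (subst card_le_Suc0_iff_eq) auto
  qed
  have c3: "card C3 \<le> 1"
  proof -
    have "e = e'" if ee: "e \<in> C3" "e' \<in> C3" for e e'
    proof -
      obtain j k where "j \<in> {1..n}" "k \<in> {1..n}" "e = (s j, t)" "e' = (s k, t)" "e \<in> M" "e' \<in> M"
        "i < j" "j < i + d" "i < k" "k < i + d"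
        using ee by (auto simp: C3_def)
      then show ?thesis using apart[of j k t] i by (cases "j = k") auto
    qed
    then show ?thesis unfolding One_nat_def using fin by (subst card_le_Suc0_iff_eq) auto
  qed
  have "{e \<in> M. \<not> distance_matching n s S T E d {x, e}} \<subseteq> C1 \<union> C2 \<union> C3"
  proof
    fix e assume "e \<in> {e \<in> M. \<not> distance_matching n s S T E d {x, e}}"
    then have e: "e \<in> M" "\<not> distance_matching n s S T E d {x, e}" by auto
    obtain j t' where j: "j \<in> {1..n}" "e = (s j, t')" using sT e ME by blast
    have "i = j \<or> t = t' \<and> \<bar>int j - int i\<bar> < int d"
      using conflict_cases[OF G, of i t j t' d] x e i j ME by auto
    then consider "i = j" | "t = t'" "j < i" "i < j + d" | "t = t'" "i < j" "j < i + d"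
      by linarith
    then show "e \<in> C1 \<union> C2 \<union> C3"
      using e j by cases (auto simp: C1_def C2_def C3_def)
  qed
  then have "card {e \<in> M. \<not> distance_matching n s S T E d {x, e}} \<le> card (C1 \<union> C2 \<union> C3)"
    using fin by (intro card_mono) auto
  also have "\<dots> \<le> card C1 + card C2 + card C3"
    using card_Un_le[of "C1 \<union> C2" C3] card_Un_le[of C1 C2] by linarith
  finally show ?thesis using c1 c2 c3 by linarith
qed

theorem theorem10:
  fixes s :: "nat \<Rightarrow> 'a" and S :: "'a set" and T :: "'b set"
    and E M Mstar :: "('a \<times> 'b) set" and n d l :: nat
  assumes "ordered_bipartite_graph n s S T E"
    and "l \<in> {1, 2, 3, 4}"
    and "distance_matching n s S T E d M"
    and "distance_matching n s S T E d Mstar"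
    and "locally_optimal n s S T E d l M Mstar"
  shows "real (card Mstar) \<le> \<rho> l * real (card M)"
proof -
  note G = assms(1) and M = assms(3) and Ms = assms(4)
  let ?D = "distance_matching n s S T E d" and ?N = "\<lambda>e. hit_set n s S T E d e M"
  have "finite S" using G by (auto simp: ordered_bipartite_graph_def bij_betw_def)
  then have finE: "finite E"
    using G finite_subset[of E "S \<times> T"] by (simp add: ordered_bipartite_graph_def)
  have ME: "M \<subseteq> E" "Mstar \<subseteq> E" using M Ms by (auto simp: distance_matching_def)
  then have fin: "finite M" "finite Mstar" using finE finite_subset by auto
  have N: "?N e \<subseteq> {x \<in> M. \<not> ?D {x, e}}" if "e \<in> Mstar" for e
    using hit_set_subset_conflicts[OF G M] ME that by blast
  have DMs: "?D {x, y}" if "x \<in> Mstar" "y \<in> Mstar" for x y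
    using Ms that by (subst (asm) distance_matching_pairwise[OF G]) blast
  interpret sparse_cover "Mstar - M" "M - Mstar" ?N l
  proof
    show "finite (Mstar - M)" "finite (M - Mstar)" using fin by auto
    \<comment> \<open>Edges of \<open>Mstar\<close> do not conflict with each other, so common edges
      are never hit and can be set aside.\<close>
    show "?N e \<subseteq> M - Mstar" if "e \<in> Mstar - M" for e
      using N[of e] DMs that by blast
    show "card {e \<in> Mstar - M. x \<in> ?N e} \<le> 3" if "x \<in> M - Mstar" for x
    proof -
      \<comment> \<open>The edges hitting \<open>x\<close> are among its conflicts in
        \<open>Mstar\<close>, so the degree bound comes from \<open>Mstar\<close> being a distance
        matching.\<close>
      have "card {e \<in> Mstar - M. x \<in> ?N e} \<le> card {e \<in> Mstar. \<not> ?D {x, e}}"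
        using fin N by (intro card_mono) auto
      also have "\<dots> \<le> 3" using card_conflicts_le_3[OF G Ms] ME that by blast
      finally show ?thesis .
    qed
    show "card X \<le> card (\<Union>e\<in>X. ?N e)" if "X \<subseteq> Mstar - M" "card X \<le> l" for X
      using assms(5) that unfolding locally_optimal_def hit_set_of_def by (meson not_le)
  qed
  \<comment> \<open>Common edges count once on each side, which is harmless for a ratio of at least
    1.\<close>
  have "\<rho> l \<ge> 1" by (simp add: \<rho>_def)
  have "real (card Mstar) = real (card (Mstar \<inter> M)) + real (card (Mstar - M))"
    using card_Int_Diff[OF fin(2), of M] by simp
  also have "\<dots> \<le> \<rho> l * real (card (M \<inter> Mstar)) + \<rho> l * real (card (M - Mstar))"
    using card_le_rho[OF assms(2)] mult_right_mono[OF \<open>\<rho> l \<ge> 1\<close>, of "real (card (M \<inter> Mstar))"]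
    by (simp add: Int_commute)
  also have "\<dots> = \<rho> l * real (card M)"
    using card_Int_Diff[OF fin(1), of Mstar] by (simp add: distrib_left)
  finally show ?thesis .
qed

end
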